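(* Let $\mathbf{x}:[0,\pi/2]\to\mathbb{R}^2$ be a rotation path with associated shape $S_{\mathbf{x}}$ and contact paths $\mathbf{A},\mathbf{B},\mathbf{C},\mathbf{D}$. Then \begin{align*} \mathbf{A}(t) &= \mathbf{x}(t) + \langle \mathbf{x}'(t),\boldsymbol{\mu}_t\rangle\,\boldsymbol{\nu}_t + \boldsymbol{\mu}_t,\\ \mathbf{B}(t) &= \mathbf{x}(t) + \langle \mathbf{x}'(t),\boldsymbol{\mu}_t\rangle\,\boldsymbol{\nu}_t,\\ \mathbf{C}(t) &= \mathbf{x}(t) - \langle \mathbf{x}'(t),\boldsymbol{\nu}_t\rangle\,\boldsymbol{\mu}_t + \boldsymbol{\nu}_t,\\ \mathbf{D}(t) &= \mathbf{x}(t) - \langle \mathbf{x}'(t),\boldsymbol{\nu}_t\rangle\,\boldsymbol{\mu}_t, \end{align*} where each of the four relations is valid at every $t$ for which the respective contact point is defined, the respective contact path is continuous at $t$, and $\mathbf{x}$ is differentiable at $t$.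
   Context: Vectors in $\mathbb{R}^2$ are column vectors and $\langle\cdot,\cdot\rangle$ is the standard inner product. Put $$L_{\mathrm{horiz}}=\{(x,y): x\le 1,\ 0\le y\le 1\},\quad L_{\mathrm{vert}}=\{(x,y): y\le 1,\ 0\le x\le 1\},\quad L=L_{\mathrm{horiz}}\cup L_{\mathrm{vert}}$$ (the $L$-shaped hallway of unit width, with inner corner $(0,0)$ and outer corner $(1,1)$). Let $$R_t=\begin{pmatrix}\cos t&-\sin t\\ \sin t&\cos t\end{pmatrix},\qquad \boldsymbol{\mu}_t=\begin{pmatrix}\cos t\\ \sin t\end{pmatrix},\qquad \boldsymbol{\nu}_t=\begin{pmatrix}-\sin t\\ \cos t\end{pmatrix}.$$ A rotation path is a continuous path $\mathbf{x}:[0,\pi/2]\to\mathbb{R}^2$ with $\mathbf{x}(0)=(0,0)^\top$. The shape associated with $\mathbf{x}$ is $$S_{\mathbf{x}} = L_{\mathrm{horiz}} \cap \bigcap_{0\le t\le \pi/2} \big(\mathbf{x}(t)+R_t(L)\big)\cap \big(\mathbf{x}(\pi/2)+R_{\pi/2}(L_{\mathrm{vert}})\big).$$ Contact points. At time $t$ the moved hallway $\mathbf{x}(t)+R_t(L)$ has its inner corner at $\mathbf{x}(t)$ and four walls (images of the four half-lines bounding $L$): the outer wall on the line $\langle \mathbf{p},\boldsymbol{\mu}_t\rangle=\langle\mathbf{x}(t),\boldsymbol{\mu}_t\rangle+1$; the inner wall $\{\mathbf{p}:\langle \mathbf{p},\boldsymbol{\mu}_t\rangle=\langle\mathbf{x}(t),\boldsymbol{\mu}_t\rangle,\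 \langle \mathbf{p},\boldsymbol{\nu}_t\rangle\le\langle\mathbf{x}(t),\boldsymbol{\nu}_t\rangle\}$; the outer wall on the line $\langle \mathbf{p},\boldsymbol{\nu}_t\rangle=\langle\mathbf{x}(t),\boldsymbol{\nu}_t\rangle+1$; the inner wall $\{\mathbf{p}:\langle \mathbf{p},\boldsymbol{\nu}_t\rangle=\langle\mathbf{x}(t),\boldsymbol{\nu}_t\rangle,\ \langle \mathbf{p},\boldsymbol{\mu}_t\rangle\le\langle\mathbf{x}(t),\boldsymbol{\mu}_t\rangle\}$. The tangency points of these walls with the shape $S_{\mathbf{x}}$ are denoted, in this order, $\mathbf{A}(t),\mathbf{B}(t),\mathbf{C}(t),\mathbf{D}(t)$ (so $\mathbf{A},\mathbf{C}$ belong to the outer walls and $\mathbf{B},\mathbf{D}$ to the inner walls). For a given $t$, one or both of $\mathbf{B}(t),\mathbf{D}(t)$ may fail to exist (be undefined). Mere touching of the shape by the inner corner $\mathbf{x}(t)$ is recorded separately and does not by itself count as a tangency point of an inner wall. It is a standing assumption that no wall has more than one tangency point with the shape. The functions $t\mapsto\mathbf{A}(t),\mathbf{B}(t),\mathbf{C}(t),\mathbf{D}(t)$ are the contact paths. *)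

theory Defs
  imports "HOL-Analysis.Analysis"
begin

definition L_horiz :: "(real^2) set" where
  "L_horiz = {p. p$1 \<le> 1 \<and> 0 \<le> p$2 \<and> p$2 \<le> 1}"

definition L_vert :: "(real^2) set" where
  "L_vert = {p. p$2 \<le> 1 \<and> 0 \<le> p$1 \<and> p$1 \<le> 1}"

definition L_hallway :: "(real^2) set" where
  "L_hallway = L_horiz \<union> L_vert"

definition rot :: "real \<Rightarrow> real^2^2" where
  "rot t = vector [vector [cos t, - sin t], vector [sin t, cos t]]"

definition \<mu> :: "real \<Rightarrow> real^2" where
  "\<mu> t = vector [cos t, sin t]"

definition \<nu> :: "real \<Rightarrow> real^2" where
  "\<nu> t = vector [- sin t, cos t]"

text \<open>Paths are total functions on the reals; only their values on the interval from
  \<open>0\<close> to \<open>pi/2\<close> matter in everything below.\<close>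

definition rotation_path :: "(real \<Rightarrow> real^2) \<Rightarrow> bool" where
  "rotation_path x \<longleftrightarrow> continuous_on {0..pi/2} x \<and> x 0 = 0"

definition moved :: "(real \<Rightarrow> real^2) \<Rightarrow> real \<Rightarrow> (real^2) set \<Rightarrow> (real^2) set" where
  "moved x t X = (\<lambda>p. x t + rot t *v p) ` X"

definition shape :: "(real \<Rightarrow> real^2) \<Rightarrow> (real^2) set" where
  "shape x = L_horiz \<inter> (\<Inter>t\<in>{0..pi/2}. moved x t L_hallway) \<inter> moved x (pi/2) L_vert"

datatype wall = Outer_mu | Inner_mu | Outer_nu | Inner_nu

text \<open>The walls are the images of the four half-lines bounding the hallway. The contact points
  on \<open>Outer_mu\<close>, \<open>Inner_mu\<close>, \<open>Outer_nu\<close>, \<open>Inner_nu\<close> are the points traditionally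
  called A, B, C, D.\<close>

fun wall_set :: "(real \<Rightarrow> real^2) \<Rightarrow> wall \<Rightarrow> real \<Rightarrow> (real^2) set" where
  "wall_set x Outer_mu t = {p. p \<bullet> \<mu> t = x t \<bullet> \<mu> t + 1 \<and> p \<bullet> \<nu> t \<le> x t \<bullet> \<nu> t + 1}"
| "wall_set x Inner_mu t = {p. p \<bullet> \<mu> t = x t \<bullet> \<mu> t \<and> p \<bullet> \<nu> t \<le> x t \<bullet> \<nu> t}"
| "wall_set x Outer_nu t = {p. p \<bullet> \<nu> t = x t \<bullet> \<nu> t + 1 \<and> p \<bullet> \<mu> t \<le> x t \<bullet> \<mu> t + 1}"
| "wall_set x Inner_nu t = {p. p \<bullet> \<nu> t = x t \<bullet> \<nu> t \<and> p \<bullet> \<mu> t \<le> x t \<bullet> \<mu> t}"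

text \<open>The shape lies inside the moved hallway, so near a common point with a wall (other than
  the inner corner) it stays on one side of that wall: every such point is a point of tangency.
  The inner corner \<open>x t\<close> lies on both inner walls; its touching the shape is not a tangency of
  either wall. It lies on no outer wall, so removing it has no effect there.\<close>

definition tangency_points :: "(real \<Rightarrow> real^2) \<Rightarrow> wall \<Rightarrow> real \<Rightarrow> (real^2) set" where
  "tangency_points x w t = (shape x \<inter> wall_set x w t) - {x t}"

definition at_most_one_tangency :: "(real \<Rightarrow> real^2) \<Rightarrow> bool" where
  "at_most_one_tangency x \<longleftrightarrow>
     (\<forall>w. \<forall>t\<in>{0..pi/2}. \<exists>\<^sub>\<le>\<^sub>1 p. p \<in> tangency_points x w t)"

text \<open>A contact path is a partial function: \<open>contact_path x w\<close> is meaningful only on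
  \<open>contact_dom x w\<close>.\<close>

definition contact_dom :: "(real \<Rightarrow> real^2) \<Rightarrow> wall \<Rightarrow> real set" where
  "contact_dom x w = {t \<in> {0..pi/2}. tangency_points x w t \<noteq> {}}"

definition contact_path :: "(real \<Rightarrow> real^2) \<Rightarrow> wall \<Rightarrow> real \<Rightarrow> real^2" where
  "contact_path x w t = (THE p. p \<in> tangency_points x w t)"

text \<open>Continuity at \<open>t\<close> is taken relative to the domain, and includes that \<open>t\<close> is an
  accumulation point of the domain: at an isolated point \<open>continuous (at t within _)\<close> would hold
  for any function whatsoever. (A contact point existing at time \<open>0\<close> but at no time shortly
  after carries no information on the derivative of \<open>x\<close> at \<open>0\<close>.)\<close>

definition contact_continuous_at :: "(real \<Rightarrow> real^2) \<Rightarrow> wall \<Rightarrow> real \<Rightarrow> bool" where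
  "contact_continuous_at x w t \<longleftrightarrow>
     t islimpt contact_dom x w \<and> continuous (at t within contact_dom x w) (contact_path x w)"

end

theory Submission
  imports Defs
begin

text \<open>
  Each wall slides along a moving line, and its contact path is the envelope of that family of
  lines. For the outer wall with normal \<open>\<mu> s\<close>, every point \<open>p\<close> of the shape satisfies
  \<open>p \<bullet> \<mu> s \<le> x s \<bullet> \<mu> s + 1\<close> at every time \<open>s\<close>, with equality for \<open>p = A s\<close>. Testing \<open>A t\<close>
  against the wall at time \<open>s\<close> and \<open>A s\<close> against the wall at time \<open>t\<close> encloses the increment of
  \<open>x s \<bullet> \<mu> s\<close> from time \<open>t\<close> to time \<open>s\<close> between \<open>A t \<bullet> (\<mu> s - \<mu> t)\<close> and \<open>A s \<bullet> (\<mu> s - \<mu> t)\<close>.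
  Continuity of the contact path makes the two bounds agree to first order, so the derivatives
  at \<open>t\<close> agree: \<open>A t \<bullet> \<nu> t = x' \<bullet> \<mu> t + x t \<bullet> \<nu> t\<close> (\<open>envelope_derivative\<close>). Both tests are made with
  the same \<open>s\<close>, so contact times may accumulate at \<open>t\<close> from one side only; the end points
  \<open>0\<close> and \<open>pi/2\<close> are thus no exception.

  The line of an inner wall bounds the shape only on one side of the inner corner: a point of
  the hallway with negative second coordinate has nonnegative first coordinate, and vice versa. As the
  contact point differs from the corner, it stays strictly on the relevant side for nearby
  times, and the same enclosure holds near \<open>t\<close>, with reversed inequalities
  (\<open>inner_envelope_derivative\<close>).

  The derivative identity gives the component of the contact point along the wall, the wall
  equation gives the component across it, and \<open>\<mu> t\<close>, \<open>\<nu> t\<close> form an orthonormal basis.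
\<close>

section \<open>The rotating frame\<close>

lemma inner_mu: "p \<bullet> \<mu> t = p$1 * cos t + p$2 * sin t"
  and inner_nu: "p \<bullet> \<nu> t = - (p$1 * sin t) + p$2 * cos t"
  by (simp_all add: \<mu>_def \<nu>_def inner_vec_def sum_2)

lemma frame_orthonormal:
  "\<mu> t \<bullet> \<mu> t = 1" "\<nu> t \<bullet> \<nu> t = 1" "\<mu> t \<bullet> \<nu> t = 0" "\<nu> t \<bullet> \<mu> t = 0"
  using sin_cos_squared_add[of t]
  unfolding inner_mu inner_nu by (simp_all add: \<mu>_def \<nu>_def power2_eq_square algebra_simps)

lemma rot_vector: "rot t *v p = p$1 *\<^sub>R \<mu> t + p$2 *\<^sub>R \<nu> t"
  by (simp add: vec_eq_iff forall_2 rot_def \<mu>_def \<nu>_def matrix_vector_mult_def sum_2)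

lemma frame_eqI:
  assumes "p \<bullet> \<mu> t = q \<bullet> \<mu> t" and "p \<bullet> \<nu> t = q \<bullet> \<nu> t"
  shows "p = q"
proof -
  have "r = (r \<bullet> \<mu> t) *\<^sub>R \<mu> t + (r \<bullet> \<nu> t) *\<^sub>R \<nu> t" for r
  proof -
    have "r$1 = cos t * (cos t * r$1) + sin t * (sin t * r$1)"
      "r$2 = cos t * (cos t * r$2) + sin t * (sin t * r$2)"
      using sin_cos_squared_add2[of t]
      by (simp_all add: power2_eq_square mult.assoc[symmetric] distrib_right[symmetric])
    then show ?thesis
      unfolding inner_mu inner_nu by (simp add: vec_eq_iff forall_2 \<mu>_def \<nu>_def algebra_simps)
  qed
  from this[of p] this[of q] show ?thesis
    using assms by simp
qed

lemma has_vector_derivative_vec2: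
  assumes "(f has_real_derivative f') (at t within D)" "(g has_real_derivative g') (at t within D)"
  shows "((\<lambda>s. vector [f s, g s] :: real^2) has_vector_derivative vector [f', g']) (at t within D)"
proof -
  have split: "vector [a, b] = a *\<^sub>R axis 1 1 + b *\<^sub>R (axis 2 1 :: real^2)" for a b
    by (simp add: vec_eq_iff forall_2 axis_def)
  show ?thesis
    unfolding split using assms
    by (auto intro!: derivative_eq_intros)
qed

lemma mu_derivative: "(\<mu> has_vector_derivative \<nu> t) (at t within D)"
  and nu_derivative: "(\<nu> has_vector_derivative - \<mu> t) (at t within D)"
proof -
  have "- \<mu> t = vector [- cos t, - sin t]"
    by (simp add: \<mu>_def vec_eq_iff forall_2)
  moreover have "((\<lambda>s. vector [cos s, sin s] :: real^2) has_vector_derivative vector [- sin t, cos t])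
      (at t within D)"
    by (rule has_vector_derivative_vec2) (auto intro!: derivative_eq_intros)
  moreover have "((\<lambda>s. vector [- sin s, cos s] :: real^2) has_vector_derivative
      vector [- cos t, - sin t]) (at t within D)"
    by (rule has_vector_derivative_vec2) (auto intro!: derivative_eq_intros)
  ultimately show "(\<mu> has_vector_derivative \<nu> t) (at t within D)"
    and "(\<nu> has_vector_derivative - \<mu> t) (at t within D)"
    by (simp_all add: \<mu>_def[abs_def] \<nu>_def[abs_def])
qed

section \<open>Derivatives of envelopes\<close>

lemma has_vector_derivative_imp_tendsto:
  assumes "(f has_vector_derivative f') (at t within D)"
  shows "((\<lambda>s. (f s - f t) /\<^sub>R (s - t)) \<longlongrightarrow> f') (at t within D)"
proof -
  have "((\<lambda>s. norm (f s - f t - (s - t) *\<^sub>R f') / norm (s - t)) \<longlongrightarrow> 0) (at t within D)"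
    using assms by (simp add: has_vector_derivative_def has_derivative_iff_norm)
  moreover have "norm (f s - f t - (s - t) *\<^sub>R f') / norm (s - t)
      = norm ((f s - f t) /\<^sub>R (s - t) - f')" if "s \<noteq> t" for s
  proof -
    have "(f s - f t) /\<^sub>R (s - t) - f' = (f s - f t - (s - t) *\<^sub>R f') /\<^sub>R (s - t)"
      using that by (simp add: scaleR_diff_right)
    then show ?thesis
      by (simp add: divide_inverse mult.commute)
  qed
  then have "\<forall>\<^sub>F s in at t within D. norm (f s - f t - (s - t) *\<^sub>R f') / norm (s - t)
      = norm ((f s - f t) /\<^sub>R (s - t) - f')"
    by (auto simp: eventually_at_filter)
  ultimately have "((\<lambda>s. norm ((f s - f t) /\<^sub>R (s - t) - f')) \<longlongrightarrow> 0) (at t within D)"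
    by (rule Lim_transform_eventually)
  then show ?thesis
    by (simp add: tendsto_norm_zero_iff LIM_zero_iff)
qed

text \<open>
  The function \<open>h s = x s \<bullet> e s + c - P t \<bullet> e s\<close> vanishes at \<open>t\<close>, and the two support inequalities
  squeeze it between \<open>0\<close> and \<open>(P s - P t) \<bullet> (e s - e t)\<close>, which is \<open>o(s - t)\<close>. Hence its derivative,
  the difference of the two sides of the conclusion, is zero.
\<close>

lemma envelope_derivative:
  fixes x P e :: "real \<Rightarrow> 'a::real_inner"
  assumes acc: "t islimpt D"
    and P: "continuous (at t within D) P"
    and x: "(x has_vector_derivative x') (at t within D)"
    and e: "(e has_vector_derivative e') (at t within D)"
    and at_t: "P t \<bullet> e t = x t \<bullet> e t + c"
    and touch: "\<And>s. s \<in> D \<Longrightarrow> P s \<bullet> e s = x s \<bullet> e s + c"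
    and fwd: "\<forall>\<^sub>F s in at t within D. P t \<bullet> e s \<le> x s \<bullet> e s + c"
    and bwd: "\<forall>\<^sub>F s in at t within D. P s \<bullet> e t \<le> x t \<bullet> e t + c"
  shows "P t \<bullet> e' = x' \<bullet> e t + x t \<bullet> e'"
proof -
  let ?F = "at t within D"
  have in_D: "\<forall>\<^sub>F s in ?F. s \<in> D"
    by (simp add: eventually_at_filter)
  define h where "h s = x s \<bullet> e s + c - P t \<bullet> e s" for s
  have "(h has_vector_derivative x t \<bullet> e' + x' \<bullet> e t - P t \<bullet> e') ?F"
    unfolding h_def using x e
    by (auto intro!: derivative_eq_intros bounded_bilinear.has_vector_derivative[OF bounded_bilinear_inner])
  then have "((\<lambda>s. (h s - h t) / (s - t)) \<longlongrightarrow> x t \<bullet> e' + x' \<bullet> e t - P t \<bullet> e') ?F"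
    by (simp add: has_real_derivative_iff_has_vector_derivative[symmetric] has_field_derivative_iff)
  moreover have "((\<lambda>s. (h s - h t) / (s - t)) \<longlongrightarrow> 0) ?F"
  proof (rule Lim_null_comparison)
    show "\<forall>\<^sub>F s in ?F. norm ((h s - h t) / (s - t)) \<le> norm (P s - P t) * norm ((e s - e t) /\<^sub>R (s - t))"
      using fwd bwd in_D
    proof eventually_elim
      case (elim s)
      have "0 \<le> h s" "h s \<le> (P s - P t) \<bullet> (e s - e t)"
        using elim touch[of s] at_t by (auto simp: h_def inner_diff_left inner_diff_right)
      then have "\<bar>h s\<bar> \<le> norm (P s - P t) * norm (e s - e t)"
        using norm_cauchy_schwarz[of "P s - P t" "e s - e t"] by linarith
      moreover have "h t = 0"
        using at_t by (simp add: h_def)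
      ultimately show ?case
        by (simp add: divide_simps)
    qed
    have "((\<lambda>s. norm (P s - P t)) \<longlongrightarrow> 0) ?F"
      using P by (simp add: continuous_within tendsto_norm_zero LIM_zero)
    moreover have "((\<lambda>s. (e s - e t) /\<^sub>R (s - t)) \<longlongrightarrow> e') ?F"
      using e by (rule has_vector_derivative_imp_tendsto)
    ultimately show "((\<lambda>s. norm (P s - P t) * norm ((e s - e t) /\<^sub>R (s - t))) \<longlongrightarrow> 0) ?F"
      using tendsto_mult[OF _ tendsto_norm] by fastforce
  qed
  moreover have "?F \<noteq> bot"
    using acc by (simp add: trivial_limit_within)
  ultimately have "x t \<bullet> e' + x' \<bullet> e t - P t \<bullet> e' = 0"
    by (metis tendsto_unique)
  then show ?thesis
    by simp
qed

text \<open>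
  Here the support inequality is available only where \<open>b\<close> places the point strictly behind the
  corner. This is an open condition, so by continuity of \<open>x\<close>, \<open>b\<close> and \<open>P\<close> it persists for times near
  \<open>t\<close>, both for \<open>P t\<close> seen at time \<open>s\<close> and for \<open>P s\<close> seen at time \<open>t\<close>. The shape lies on the positive
  side of an inner wall, so the envelope argument is applied to the normal \<open>- e\<close>.
\<close>

lemma inner_envelope_derivative:
  fixes x P e b :: "real \<Rightarrow> 'a::real_inner"
  assumes acc: "t islimpt D" and "t \<in> D"
    and P: "continuous (at t within D) P"
    and x: "(x has_vector_derivative x') (at t within D)"
    and e: "(e has_vector_derivative e') (at t within D)"
    and b: "continuous (at t within D) b"
    and behind: "P t \<bullet> b t < x t \<bullet> b t"
    and touch: "\<And>s. s \<in> D \<Longrightarrow> P s \<bullet> e s = x s \<bullet> e s"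
    and support: "\<And>s r. s \<in> D \<Longrightarrow> r \<in> D \<Longrightarrow> P s \<bullet> b r < x r \<bullet> b r \<Longrightarrow> x r \<bullet> e r \<le> P s \<bullet> e r"
  shows "P t \<bullet> e' = x' \<bullet> e t + x t \<bullet> e'"
proof -
  let ?F = "at t within D"
  have in_D: "\<forall>\<^sub>F s in ?F. s \<in> D"
    by (simp add: eventually_at_filter)
  have lim: "(P \<longlongrightarrow> P t) ?F" "(b \<longlongrightarrow> b t) ?F" "(x \<longlongrightarrow> x t) ?F"
    using P b has_vector_derivative_continuous[OF x] by (auto simp: continuous_within)
  have "((\<lambda>s. x s \<bullet> b s - P t \<bullet> b s) \<longlongrightarrow> x t \<bullet> b t - P t \<bullet> b t) ?F"
    by (intro tendsto_intros lim)
  then have "\<forall>\<^sub>F s in ?F. 0 < x s \<bullet> b s - P t \<bullet> b s"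
    by (rule order_tendstoD) (use behind in simp)
  then have fwd: "\<forall>\<^sub>F s in ?F. P t \<bullet> - e s \<le> x s \<bullet> - e s + 0"
    using in_D by eventually_elim (use support \<open>t \<in> D\<close> in simp)
  have "((\<lambda>s. P s \<bullet> b t) \<longlongrightarrow> P t \<bullet> b t) ?F"
    by (intro tendsto_intros lim)
  then have "\<forall>\<^sub>F s in ?F. P s \<bullet> b t < x t \<bullet> b t"
    by (rule order_tendstoD) (use behind in simp)
  then have bwd: "\<forall>\<^sub>F s in ?F. P s \<bullet> - e t \<le> x t \<bullet> - e t + 0"
    using in_D by eventually_elim (use support \<open>t \<in> D\<close> in simp)
  have "P t \<bullet> - e' = x' \<bullet> - e t + x t \<bullet> - e'"
    by (rule envelope_derivative[OF acc P x _ _ _ fwd bwd])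
      (use touch \<open>t \<in> D\<close> e in \<open>auto intro!: derivative_eq_intros\<close>)
  then show ?thesis
    by simp
qed

section \<open>Contact points and the hallway\<close>

lemma shape_in_hallway:
  assumes "p \<in> shape x" and "s \<in> {0..pi/2}"
  shows "p \<bullet> \<mu> s \<le> x s \<bullet> \<mu> s + 1"
    and "p \<bullet> \<nu> s \<le> x s \<bullet> \<nu> s + 1"
    and "p \<bullet> \<nu> s < x s \<bullet> \<nu> s \<Longrightarrow> x s \<bullet> \<mu> s \<le> p \<bullet> \<mu> s"
    and "p \<bullet> \<mu> s < x s \<bullet> \<mu> s \<Longrightarrow> x s \<bullet> \<nu> s \<le> p \<bullet> \<nu> s"
proof -
  from assms have "p \<in> moved x s L_hallway"
    by (auto simp: shape_def)
  then obtain q where "q \<in> L_hallway" and p: "p = x s + rot s *v q"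
    by (auto simp: moved_def)
  then have q: "q$1 \<le> 1" "q$2 \<le> 1" "q$2 < 0 \<Longrightarrow> 0 \<le> q$1" "q$1 < 0 \<Longrightarrow> 0 \<le> q$2"
    by (auto simp: L_hallway_def L_horiz_def L_vert_def)
  have "p \<bullet> \<mu> s = x s \<bullet> \<mu> s + q$1" "p \<bullet> \<nu> s = x s \<bullet> \<nu> s + q$2"
    by (simp_all add: p rot_vector inner_add_left frame_orthonormal)
  with q show "p \<bullet> \<mu> s \<le> x s \<bullet> \<mu> s + 1" "p \<bullet> \<nu> s \<le> x s \<bullet> \<nu> s + 1"
    "p \<bullet> \<nu> s < x s \<bullet> \<nu> s \<Longrightarrow> x s \<bullet> \<mu> s \<le> p \<bullet> \<mu> s"
    "p \<bullet> \<mu> s < x s \<bullet> \<mu> s \<Longrightarrow> x s \<bullet> \<nu> s \<le> p \<bullet> \<nu> s"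
    by auto
qed

lemma contact_path_tangency:
  assumes "at_most_one_tangency x" and "s \<in> contact_dom x w"
  shows "contact_path x w s \<in> shape x" and "contact_path x w s \<in> wall_set x w s"
    and "contact_path x w s \<noteq> x s"
proof -
  have "s \<in> {0..pi/2}" "tangency_points x w s \<noteq> {}"
    using assms(2) by (auto simp: contact_dom_def)
  then have "\<exists>!p. p \<in> tangency_points x w s"
    using assms(1) unfolding at_most_one_tangency_def Uniq_def by blast
  then have "contact_path x w s \<in> tangency_points x w s"
    unfolding contact_path_def by (rule theI')
  then show "contact_path x w s \<in> shape x" "contact_path x w s \<in> wall_set x w s"
    "contact_path x w s \<noteq> x s"
    by (auto simp: tangency_points_def)
qed

theorem theorem1:
  fixes x :: "real \<Rightarrow> real^2" and t :: real and x' :: "real^2"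
  assumes "rotation_path x"
    and "at_most_one_tangency x"
    and "t \<in> {0..pi/2}"
    and "(x has_vector_derivative x') (at t within {0..pi/2})"
  shows
    "(t \<in> contact_dom x Outer_mu \<and> contact_continuous_at x Outer_mu t \<longrightarrow>
        contact_path x Outer_mu t = x t + (x' \<bullet> \<mu> t) *\<^sub>R \<nu> t + \<mu> t) \<and>
     (t \<in> contact_dom x Inner_mu \<and> contact_continuous_at x Inner_mu t \<longrightarrow>
        contact_path x Inner_mu t = x t + (x' \<bullet> \<mu> t) *\<^sub>R \<nu> t) \<and>
     (t \<in> contact_dom x Outer_nu \<and> contact_continuous_at x Outer_nu t \<longrightarrow>
        contact_path x Outer_nu t = x t - (x' \<bullet> \<nu> t) *\<^sub>R \<mu> t + \<nu> t) \<and>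
     (t \<in> contact_dom x Inner_nu \<and> contact_continuous_at x Inner_nu t \<longrightarrow>
        contact_path x Inner_nu t = x t - (x' \<bullet> \<nu> t) *\<^sub>R \<mu> t)"
proof -
  note contact = contact_path_tangency[OF assms(2)]
  have dom: "s \<in> {0..pi/2}" if "s \<in> contact_dom x w" for s w
    using that by (simp add: contact_dom_def)
  have x: "(x has_vector_derivative x') (at t within contact_dom x w)" for w
    using assms(4) by (rule has_vector_derivative_within_subset) (auto simp: contact_dom_def)
  have in_dom: "\<forall>\<^sub>F s in at t within contact_dom x w. s \<in> contact_dom x w" for w
    by (simp add: eventually_at_filter)
  note \<mu>_cont = has_vector_derivative_continuous[OF mu_derivative]
  note \<nu>_cont = has_vector_derivative_continuous[OF nu_derivative]
  note frame_simps = inner_add_left inner_diff_left frame_orthonormal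

  have A: "contact_path x Outer_mu t = x t + (x' \<bullet> \<mu> t) *\<^sub>R \<nu> t + \<mu> t"
    if t: "t \<in> contact_dom x Outer_mu" and c: "contact_continuous_at x Outer_mu t"
  proof -
    let ?A = "contact_path x Outer_mu"
    have "?A t \<bullet> \<nu> t = x' \<bullet> \<mu> t + x t \<bullet> \<nu> t"
    proof (rule envelope_derivative[OF _ _ x mu_derivative])
      show "\<forall>\<^sub>F s in at t within contact_dom x Outer_mu. ?A t \<bullet> \<mu> s \<le> x s \<bullet> \<mu> s + 1"
        using in_dom by eventually_elim (use contact(1)[OF t] shape_in_hallway(1) dom in blast)
      show "\<forall>\<^sub>F s in at t within contact_dom x Outer_mu. ?A s \<bullet> \<mu> t \<le> x t \<bullet> \<mu> t + 1"
        using in_dom by eventually_elim (use contact(1) shape_in_hallway(1) assms(3) in blast)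
    qed (use c t contact(2)[where w = Outer_mu] in \<open>auto simp: contact_continuous_at_def\<close>)
    then show ?thesis
      using contact(2)[OF t] by (intro frame_eqI[of _ t]) (auto simp: frame_simps)
  qed

  have C: "contact_path x Outer_nu t = x t - (x' \<bullet> \<nu> t) *\<^sub>R \<mu> t + \<nu> t"
    if t: "t \<in> contact_dom x Outer_nu" and c: "contact_continuous_at x Outer_nu t"
  proof -
    let ?C = "contact_path x Outer_nu"
    have "?C t \<bullet> - \<mu> t = x' \<bullet> \<nu> t + x t \<bullet> - \<mu> t"
    proof (rule envelope_derivative[OF _ _ x nu_derivative])
      show "\<forall>\<^sub>F s in at t within contact_dom x Outer_nu. ?C t \<bullet> \<nu> s \<le> x s \<bullet> \<nu> s + 1"
        using in_dom by eventually_elim (use contact(1)[OF t] shape_in_hallway(2) dom in blast)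
      show "\<forall>\<^sub>F s in at t within contact_dom x Outer_nu. ?C s \<bullet> \<nu> t \<le> x t \<bullet> \<nu> t + 1"
        using in_dom by eventually_elim (use contact(1) shape_in_hallway(2) assms(3) in blast)
    qed (use c t contact(2)[where w = Outer_nu] in \<open>auto simp: contact_continuous_at_def\<close>)
    then show ?thesis
      using contact(2)[OF t] by (intro frame_eqI[of _ t]) (auto simp: frame_simps)
  qed

  have B: "contact_path x Inner_mu t = x t + (x' \<bullet> \<mu> t) *\<^sub>R \<nu> t"
    if t: "t \<in> contact_dom x Inner_mu" and c: "contact_continuous_at x Inner_mu t"
  proof -
    let ?B = "contact_path x Inner_mu"
    have "?B t \<bullet> \<nu> t = x' \<bullet> \<mu> t + x t \<bullet> \<nu> t"
    proof (rule inner_envelope_derivative[OF _ t _ x mu_derivative \<nu>_cont])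
      \<comment> \<open>Strict, since the corner itself is not a tangency point.\<close>
      show "?B t \<bullet> \<nu> t < x t \<bullet> \<nu> t"
        using contact(2,3)[OF t] frame_eqI[of "?B t" t "x t"] by fastforce
      show "x r \<bullet> \<mu> r \<le> ?B s \<bullet> \<mu> r" if "s \<in> contact_dom x Inner_mu" "r \<in> contact_dom x Inner_mu"
        "?B s \<bullet> \<nu> r < x r \<bullet> \<nu> r" for s r
        using that shape_in_hallway(3) contact(1) dom by blast
    qed (use c contact(2)[where w = Inner_mu] in \<open>auto simp: contact_continuous_at_def\<close>)
    then show ?thesis
      using contact(2)[OF t] by (intro frame_eqI[of _ t]) (auto simp: frame_simps)
  qed

  have D: "contact_path x Inner_nu t = x t - (x' \<bullet> \<nu> t) *\<^sub>R \<mu> t"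
    if t: "t \<in> contact_dom x Inner_nu" and c: "contact_continuous_at x Inner_nu t"
  proof -
    let ?D = "contact_path x Inner_nu"
    have "?D t \<bullet> - \<mu> t = x' \<bullet> \<nu> t + x t \<bullet> - \<mu> t"
    proof (rule inner_envelope_derivative[OF _ t _ x nu_derivative \<mu>_cont])
      show "?D t \<bullet> \<mu> t < x t \<bullet> \<mu> t"
        using contact(2,3)[OF t] frame_eqI[of "?D t" t "x t"] by fastforce
      show "x r \<bullet> \<nu> r \<le> ?D s \<bullet> \<nu> r" if "s \<in> contact_dom x Inner_nu" "r \<in> contact_dom x Inner_nu"
        "?D s \<bullet> \<mu> r < x r \<bullet> \<mu> r" for s r
        using that shape_in_hallway(4) contact(1) dom by blast
    qed (use c contact(2)[where w = Inner_nu] in \<open>auto simp: contact_continuous_at_def\<close>)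
    then show ?thesis
      using contact(2)[OF t] by (intro frame_eqI[of _ t]) (auto simp: frame_simps)
  qed

  from A B C D show ?thesis
    by blast
qed

end
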